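(* Let $w \in \mathfrak{S}_n$ and $k \in [1,n-1]$. Then $\max_k(w) > \min_k(w)$ if and only if there exist positions $i<p<j$ with $w(i)>w(p)>w(j)$ and $i \le k < j$ such that the sets $$L_w := \{w(q) : i < q \le k,\ w(q) > w(i)\} \quad\text{and}\quad R_w := \{w(q) : k < q < j,\ w(q) < w(j)\}$$ satisfy both of the following: \begin{itemize} \item $|L_w| = |R_w|$, and \item the elements of $L_w$ appear in increasing order from left to right in $w$, and the elements of $R_w$ appear in increasing order from left to right in $w$. \end{itemize}
   Context: $\mathfrak{S}_n$ is the symmetric group on $[1,n]$, written in one-line notation $w=w(1)\cdots w(n)$; $\sigma_i$ is the simple reflection exchanging $i$ and $i+1$. $\min_k(w)$ and $\max_k(w)$ are the minimum and maximum, over all reduced decompositions (minimal-length expressions as products of simple reflections) of $w$, of the number of occurrences of the factor $\sigma_k$. *)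

theory Defs
  imports "HOL-Combinatorics.Combinatorics"
begin

text \<open>
  A word \<open>[a, b, \<dots>]\<close> of indices stands for the product \<open>\<sigma>\<^sub>a \<circ> \<sigma>\<^sub>b \<circ> \<dots>\<close> of simple reflections,
  so right multiplication acts on positions of the one-line notation. The opposite convention
  reverses all words, and so yields the same occurrence counts.
\<close>

definition decompositions :: "nat \<Rightarrow> (nat \<Rightarrow> nat) \<Rightarrow> nat list set" where
  "decompositions n w = {xs. set xs \<subseteq> {1..<n} \<and> apply_adj_transps xs = w}"

definition reduced_decompositions :: "nat \<Rightarrow> (nat \<Rightarrow> nat) \<Rightarrow> nat list set" where
  "reduced_decompositions n w =
     {xs \<in> decompositions n w. \<forall>ys \<in> decompositions n w. length xs \<le> length ys}"

definition max_occ :: "nat \<Rightarrow> nat \<Rightarrow> (nat \<Rightarrow> nat) \<Rightarrow> nat" where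
  "max_occ n k w = Max ((\<lambda>xs. count_list xs k) ` reduced_decompositions n w)"

definition min_occ :: "nat \<Rightarrow> nat \<Rightarrow> (nat \<Rightarrow> nat) \<Rightarrow> nat" where
  "min_occ n k w = Min ((\<lambda>xs. count_list xs k) ` reduced_decompositions n w)"

definition L_set :: "(nat \<Rightarrow> nat) \<Rightarrow> nat \<Rightarrow> nat \<Rightarrow> nat set" where
  "L_set w k i = {w q |q. i < q \<and> q \<le> k \<and> w q > w i}"

definition R_set :: "(nat \<Rightarrow> nat) \<Rightarrow> nat \<Rightarrow> nat \<Rightarrow> nat set" where
  "R_set w k j = {w q |q. k < q \<and> q < j \<and> w q < w j}"

text \<open>\<open>S\<close> is a set of values of \<open>w\<close>; \<open>w -` S\<close> is the set of positions at which they appear.\<close>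

definition appear_increasing :: "(nat \<Rightarrow> nat) \<Rightarrow> nat set \<Rightarrow> bool" where
  "appear_increasing w S \<longleftrightarrow> strict_mono_on (w -` S) w"

text \<open>The sets under \<^term>\<open>Max\<close> and \<^term>\<open>Min\<close> above are finite and nonempty.\<close>

lemma finite_reduced_decompositions: "finite (reduced_decompositions n w)"
proof (cases "reduced_decompositions n w = {}")
  case False
  then obtain ys where "ys \<in> reduced_decompositions n w" by blast
  then have "reduced_decompositions n w \<subseteq> {xs. set xs \<subseteq> {1..<n} \<and> length xs \<le> length ys}"
    by (auto simp: reduced_decompositions_def decompositions_def)
  then show ?thesis
    by (rule finite_subset) (simp add: finite_lists_length_le)
qed simp

lemma apply_adj_transps_append:
  "apply_adj_transps (xs @ ys) = apply_adj_transps xs \<circ> apply_adj_transps ys"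
  by (induction xs) (auto simp: o_assoc)

lemma transpose_decomposition:
  assumes "a \<in> {1..n}" "b \<in> {1..n}"
  shows "\<exists>xs. set xs \<subseteq> {1..<n} \<and> apply_adj_transps xs = Transposition.transpose a b"
  using assms
proof (induction a b rule: linorder_wlog)
  case (le a b)
  show ?case
  proof (cases "a = b")
    case True
    then show ?thesis by (intro exI[of _ "[]"]) simp
  next
    case False
    with le have "a < b" by simp
    then show ?thesis
      using le by (intro exI[of _ "adj_transp_seq a b"])
        (auto simp: adj_transp_seq_correct set_adj_transp_seq)
  qed
next
  case (sym a b)
  then show ?case by (simp add: transpose_commute)
qed

lemma reduced_decompositions_nonempty:
  assumes "w permutes {1..n}"
  shows "reduced_decompositions n w \<noteq> {}"
proof -
  obtain ts where ts: "\<forall>(a,b)\<in>set ts. a \<in> {1..n} \<and> b \<in> {1..n} \<and> a \<noteq> b" "apply_transps ts = w"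
    using permutes_from_transpositions[OF assms] by auto
  have "\<exists>xs. set xs \<subseteq> {1..<n} \<and> apply_adj_transps xs = apply_transps ts"
    using ts(1)
  proof (induction ts)
    case Nil
    show ?case by (intro exI[of _ "[]"]) simp
  next
    case (Cons t ts)
    obtain xs where xs: "set xs \<subseteq> {1..<n}" "apply_adj_transps xs = apply_transps ts"
      using Cons by auto
    obtain ys where ys: "set ys \<subseteq> {1..<n}"
        "apply_adj_transps ys = Transposition.transpose (fst t) (snd t)"
      using transpose_decomposition[of "fst t" n "snd t"] Cons.prems by auto
    show ?case
      using xs ys by (intro exI[of _ "ys @ xs"]) (simp add: apply_adj_transps_append)
  qed
  then obtain xs where "xs \<in> decompositions n w"
    using ts(2) by (auto simp: decompositions_def)
  then obtain ys where "ys \<in> decompositions n w" "\<forall>zs\<in>decompositions n w. length ys \<le> length zs"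
    using ex_has_least_nat[of "\<lambda>xs. xs \<in> decompositions n w" xs length] by blast
  then show ?thesis
    by (auto simp: reduced_decompositions_def)
qed

end

theory Submission
  imports Defs
begin

text \<open>
  Only braid moves change the number of occurrences of \<open>\<sigma>\<^sub>k\<close>, so the maximum exceeds the minimum iff
  some reduced word has a factor \<open>\<sigma>\<^sub>m \<sigma>\<^sub>m\<^sub>+\<^sub>1 \<sigma>\<^sub>m\<close> with \<open>k \<in> {m, m + 1}\<close>. Order the positions
  by \<open>q \<le> q'\<close> and \<open>w q \<le> w q'\<close>. A prefix of a reduced word splits the positions into an order
  ideal, whose values come first, and the rest; such a factor therefore reverses a three-element
  antichain \<open>i < p < j\<close> sitting just above an ideal of size \<open>m - 1\<close>. An ideal of size \<open>k - 1\<close> or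
  \<open>k - 2\<close> exists below the antichain iff fewer than \<open>k\<close> positions lie strictly below some element
  of it and fewer than \<open>n - k\<close> strictly above some element of it.

  If \<open>p \<le> k\<close>, the second bound says that more than \<open>card L\<close> positions to the right of \<open>k\<close> have
  values below \<open>w p\<close>. Growing increasing chains from the extreme values inwards on both sides of the
  cut then yields ends with equal and increasing sets \<open>L\<close> and \<open>R\<close>; the case \<open>p > k\<close> is
  symmetric. Conversely, \<open>card L = card R\<close> gives both bounds by counting.
\<close>

subsection \<open>Reduced words and inversions\<close>

abbreviation (input) adj :: "nat \<Rightarrow> nat \<Rightarrow> nat" where
  "adj a \<equiv> Transposition.transpose a (Suc a)"

text \<open>Inversions are recorded as pairs of values, not of positions: right multiplication by an
  adjacent transposition then adds or removes a single pair, so inversion sets can be compared along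
  a word.\<close>

definition value_inversions :: "(nat \<Rightarrow> nat) \<Rightarrow> (nat \<times> nat) set" where
  "value_inversions u = {(x, y). x < y \<and> inv u y < inv u x}"

lemma mem_value_inversions_iff:
  assumes "bij u"
  shows "(u p, u q) \<in> value_inversions u \<longleftrightarrow> u p < u q \<and> q < p"
  using assms by (simp add: value_inversions_def bij_is_inj)

lemma value_inversions_id [simp]: "value_inversions id = {}"
  by (auto simp: value_inversions_def)

lemma value_inversions_ascent:
  assumes "bij u" "u a < u (Suc a)"
  shows "value_inversions (u \<circ> adj a) = insert (u a, u (Suc a)) (value_inversions u)"
proof -
  have b: "bij (u \<circ> adj a)"
    using assms by (intro bij_comp) auto
  have "(x, y) \<in> value_inversions (u \<circ> adj a) \<longleftrightarrow>
        (x, y) \<in> insert (u a, u (Suc a)) (value_inversions u)" for x y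
  proof -
    obtain p q where xy: "x = u p" "y = u q"
      using assms(1) by (metis bij_pointE)
    have "(x, y) = ((u \<circ> adj a) (adj a p), (u \<circ> adj a) (adj a q))"
      by (simp add: xy)
    then have "(x, y) \<in> value_inversions (u \<circ> adj a) \<longleftrightarrow> u p < u q \<and> adj a q < adj a p"
      using mem_value_inversions_iff[OF b, of "adj a p" "adj a q"] by simp
    also have "\<dots> \<longleftrightarrow> p = a \<and> q = Suc a \<or> u p < u q \<and> q < p"
      using assms(2) by (auto simp: Transposition.transpose_def)
    also have "\<dots> \<longleftrightarrow> (x, y) \<in> insert (u a, u (Suc a)) (value_inversions u)"
      using assms(1) mem_value_inversions_iff[OF assms(1)] by (auto simp: xy bij_is_inj inj_eq)
    finally show ?thesis .
  qed
  then show ?thesis by auto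
qed

lemma value_inversions_subset:
  assumes "u permutes {1..n}"
  shows "value_inversions u \<subseteq> {1..n} \<times> {1..n}"
proof
  have out: "inv u x = x" if "x \<notin> {1..n}" for x
    using permutes_inv[OF assms] that by (rule permutes_not_in)
  have inside: "inv u x \<in> {1..n}" if "x \<in> {1..n}" for x
    using permutes_in_image[OF permutes_inv[OF assms], of x] that by simp
  fix z assume "z \<in> value_inversions u"
  then obtain x y where z: "z = (x, y)" and xy: "x < y" "inv u y < inv u x"
    by (auto simp: value_inversions_def)
  show "z \<in> {1..n} \<times> {1..n}"
    using out[of x] out[of y] inside[of x] inside[of y] xy z
    by (cases "x \<in> {1..n}"; cases "y \<in> {1..n}") auto
qed

lemma finite_value_inversions: "u permutes {1..n} \<Longrightarrow> finite (value_inversions u)"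
  by (rule finite_subset[OF value_inversions_subset]) auto

lemma card_value_inversions_ascent:
  assumes "u permutes {1..n}" "u a < u (Suc a)"
  shows "card (value_inversions (u \<circ> adj a)) = Suc (card (value_inversions u))"
proof -
  have "bij u" using assms(1) by (rule permutes_bij)
  then have "(u a, u (Suc a)) \<notin> value_inversions u"
    using mem_value_inversions_iff by auto
  then show ?thesis
    using value_inversions_ascent[OF \<open>bij u\<close> assms(2)] finite_value_inversions[OF assms(1)] by simp
qed

lemma adj_permutes: "a \<in> {1..<n} \<Longrightarrow> adj a permutes {1..n}"
  by (intro permutes_swap_id) auto

lemma permutes_comp_adj:
  assumes "u permutes {1..n}" "a \<in> {1..<n}"
  shows "u \<circ> adj a permutes {1..n}"
  using permutes_compose[OF adj_permutes[OF assms(2)] assms(1)] .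

lemma card_value_inversions_descent:
  assumes "u permutes {1..n}" "a \<in> {1..<n}" "u (Suc a) < u a"
  shows "card (value_inversions u) = Suc (card (value_inversions (u \<circ> adj a)))"
  using card_value_inversions_ascent[of "u \<circ> adj a" n a] permutes_comp_adj[OF assms(1,2)] assms(3)
  by (simp add: comp_assoc)

section \<open>Reduced words and the weak order\<close>

lemma word_permutes:
  assumes "set xs \<subseteq> {1..<n}"
  shows "apply_adj_transps xs permutes {1..n}"
  using assms by (intro permutes_apply_adj_transps) auto

lemma card_value_inversions_le_length:
  assumes "set xs \<subseteq> {1..<n}"
  shows "card (value_inversions (apply_adj_transps xs)) \<le> length xs"
  using assms
proof (induction xs rule: rev_induct)
  case (snoc a xs)
  let ?u = "apply_adj_transps xs"
  have u: "?u permutes {1..n}" "a \<in> {1..<n}" using snoc.prems word_permutes[of xs n] by auto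
  have "?u a \<noteq> ?u (Suc a)"
    using permutes_inj[OF u(1)] by (simp add: inj_eq)
  then consider "?u a < ?u (Suc a)" | "?u (Suc a) < ?u a" by linarith
  then have "card (value_inversions (?u \<circ> adj a)) \<le> Suc (card (value_inversions ?u))"
    using card_value_inversions_ascent[OF u(1)] card_value_inversions_descent[OF u] by cases auto
  moreover have "card (value_inversions ?u) \<le> length xs" using snoc by simp
  ultimately show ?case unfolding apply_adj_transps_snoc Suc_eq_plus1 length_append_singleton by linarith
qed simp

text \<open>An intrinsic test in place of minimality among all words;
  \<open>reduced_decompositions_eq\<close> shows that the two agree.\<close>

definition reduced_word :: "nat \<Rightarrow> nat list \<Rightarrow> bool" where
  "reduced_word n xs \<longleftrightarrow> set xs \<subseteq> {1..<n} \<and>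
     card (value_inversions (apply_adj_transps xs)) = length xs"

text \<open>A letter at a descent lowers the inversion count, which then falls short of the length,
  since no word has fewer letters than inversions.\<close>

lemma reduced_word_snoc:
  "reduced_word n (xs @ [a]) \<longleftrightarrow>
     reduced_word n xs \<and> a \<in> {1..<n} \<and> apply_adj_transps xs a < apply_adj_transps xs (Suc a)"
proof (cases "set xs \<subseteq> {1..<n} \<and> a \<in> {1..<n}")
  case True
  let ?u = "apply_adj_transps xs"
  have u: "?u permutes {1..n}" "a \<in> {1..<n}" using True word_permutes[of xs n] by auto
  have "?u a \<noteq> ?u (Suc a)"
    using permutes_inj[OF u(1)] by (simp add: inj_eq)
  then consider "?u a < ?u (Suc a)" | "?u (Suc a) < ?u a" by linarith
  then show ?thesis
  proof cases
    case 1
    then show ?thesis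
      using True card_value_inversions_ascent[OF u(1) 1] by (auto simp: reduced_word_def)
  next
    case 2
    then show ?thesis
      using True card_value_inversions_descent[OF u 2] card_value_inversions_le_length[of xs n]
      by (auto simp: reduced_word_def)
  qed
qed (auto simp: reduced_word_def)

text \<open>In a reduced word every letter acts at an ascent, so inversions are added and never
  removed.\<close>

lemma reduced_word_prefix:
  assumes "reduced_word n (xs @ ys)"
  shows "reduced_word n xs \<and>
    value_inversions (apply_adj_transps xs) \<subseteq> value_inversions (apply_adj_transps (xs @ ys))"
  using assms
proof (induction ys rule: rev_induct)
  case (snoc a ys)
  have r: "reduced_word n (xs @ ys)"
    and a: "apply_adj_transps (xs @ ys) a < apply_adj_transps (xs @ ys) (Suc a)"
    using snoc.prems reduced_word_snoc[of n "xs @ ys" a] by auto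
  have "bij (apply_adj_transps (xs @ ys))"
    using r word_permutes permutes_bij unfolding reduced_word_def by blast
  from value_inversions_ascent[OF this a]
  have "value_inversions (apply_adj_transps (xs @ ys)) \<subseteq> value_inversions (apply_adj_transps (xs @ ys @ [a]))"
    using apply_adj_transps_snoc[of "xs @ ys" a] by (metis Suc_eq_plus1 append_assoc subset_insertI)
  then show ?case using snoc.IH[OF r] by blast
qed simp

text \<open>Climbing from \<open>1\<close> gives \<open>x \<le> f x\<close>, and descending from
  \<open>n\<close> gives \<open>f x \<le> x\<close>.\<close>

lemma strict_mono_permutes_eq_id:
  assumes "f permutes {1..n}" "\<And>a. a \<in> {1..<n} \<Longrightarrow> f a < f (Suc a)"
  shows "f = id"
proof -
  have img: "f x \<in> {1..n}" if "x \<in> {1..n}" for x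
    using permutes_in_image[OF assms(1), of x] that by simp
  have lower: "x \<le> n \<Longrightarrow> 1 \<le> x \<Longrightarrow> x \<le> f x" for x
  proof (induction x)
    case (Suc x)
    show ?case
    proof (cases "x = 0")
      case True
      then show ?thesis using img[of "Suc x"] Suc.prems by simp
    next
      case False
      then show ?thesis using Suc assms(2)[of x] by simp
    qed
  qed simp
  have upper: "d < n \<Longrightarrow> f (n - d) \<le> n - d" for d
  proof (induction d)
    case 0
    then show ?case using img[of n] by simp
  next
    case (Suc d)
    then have "f (n - d) \<le> n - d" by simp
    moreover have "f (n - Suc d) < f (Suc (n - Suc d))" using assms(2)[of "n - Suc d"] Suc.prems by simp
    ultimately show ?case using Suc.prems by (simp add: Suc_diff_Suc)
  qed
  show ?thesis
  proof
    fix x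
    show "f x = id x"
    proof (cases "x \<in> {1..n}")
      case True
      then show ?thesis using lower[of x] upper[of "n - x"] by simp
    next
      case False
      then show ?thesis using permutes_not_in[OF assms(1)] by simp
    qed
  qed
qed

text \<open>Containment of inversion sets is the weak order: if no step is possible, \<open>inv w \<circ> u\<close> has no descent.\<close>

lemma weak_order_word:
  assumes "u permutes {1..n}" "w permutes {1..n}" "value_inversions u \<subseteq> value_inversions w"
  shows "\<exists>zs. set zs \<subseteq> {1..<n} \<and> w = u \<circ> apply_adj_transps zs \<and>
    card (value_inversions u) + length zs = card (value_inversions w)"
  using assms
proof (induction "card (value_inversions w) - card (value_inversions u)" arbitrary: u rule: less_induct)
  case less
  note u = less.prems(1) and w = less.prems(2) and sub = less.prems(3)
  have bu: "bij u" and bw: "bij w" using u w permutes_bij by auto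
  show ?case
  proof (cases "u = w")
    case True
    then show ?thesis by (intro exI[of _ "[]"]) simp
  next
    case False
    have p: "inv w \<circ> u permutes {1..n}"
      using permutes_compose[OF u permutes_inv[OF w]] .
    have "inv w \<circ> u \<noteq> id"
    proof
      assume "inv w \<circ> u = id"
      then have "w \<circ> (inv w \<circ> u) = w" by simp
      then show False using False bw
        by (metis bij_is_surj fun.map_id0 id_comp o_assoc surj_iff)
    qed
    then obtain a where a: "a \<in> {1..<n}" "\<not> (inv w \<circ> u) a < (inv w \<circ> u) (Suc a)"
      using strict_mono_permutes_eq_id[OF p] by blast
    have ne: "(inv w \<circ> u) a \<noteq> (inv w \<circ> u) (Suc a)"
      using permutes_inj[OF p] by (metis inj_eq n_not_Suc_n)
    have une: "u a \<noteq> u (Suc a)"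
      using permutes_inj[OF u] by (simp add: inj_eq)
    \<comment> \<open>In \<open>w\<close> the values \<open>u a\<close> and \<open>u (Suc a)\<close>
      stand in the opposite order. Hence \<open>u\<close> ascends at \<open>a\<close>, as
      \<open>w\<close> keeps all inversions of \<open>u\<close>, and the exchange adds an inversion
      of \<open>w\<close>.\<close>
    have asc: "u a < u (Suc a)"
    proof (rule ccontr)
      assume "\<not> u a < u (Suc a)"
      then have "(u (Suc a), u a) \<in> value_inversions u"
        using mem_value_inversions_iff[OF bu] une by auto
      then have "(u (Suc a), u a) \<in> value_inversions w" using sub by blast
      then show False using a(2) by (auto simp: value_inversions_def)
    qed
    have "(u a, u (Suc a)) \<in> value_inversions w"
      using asc a(2) ne by (auto simp: value_inversions_def)
    then have sub': "value_inversions (u \<circ> adj a) \<subseteq> value_inversions w"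
      using sub value_inversions_ascent[OF bu asc] by simp
    have c: "card (value_inversions (u \<circ> adj a)) = Suc (card (value_inversions u))"
      using card_value_inversions_ascent[OF u asc] .
    moreover have "card (value_inversions (u \<circ> adj a)) \<le> card (value_inversions w)"
      using sub' finite_value_inversions[OF w] by (rule card_mono[rotated])
    ultimately have "card (value_inversions w) - card (value_inversions (u \<circ> adj a))
        < card (value_inversions w) - card (value_inversions u)" by linarith
    from less.hyps[OF this permutes_comp_adj[OF u a(1)] w sub']
    obtain zs where "set zs \<subseteq> {1..<n}" "w = u \<circ> adj a \<circ> apply_adj_transps zs"
      "card (value_inversions (u \<circ> adj a)) + length zs = card (value_inversions w)" by blast
    then show ?thesis
      using a(1) c by (intro exI[of _ "a # zs"]) (auto simp: o_assoc)
  qed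
qed

lemma ex_reduced_word:
  assumes "w permutes {1..n}"
  shows "\<exists>xs. reduced_word n xs \<and> apply_adj_transps xs = w"
  using weak_order_word[OF permutes_id assms] by (auto simp: reduced_word_def)

text \<open>The least length of a word for \<open>w\<close> is its number of inversions: no word is
  shorter, and some word attains it.\<close>

lemma reduced_decompositions_eq:
  assumes "w permutes {1..n}"
  shows "reduced_decompositions n w = {xs. reduced_word n xs \<and> apply_adj_transps xs = w}"
proof -
  obtain zs where zs: "reduced_word n zs" "apply_adj_transps zs = w"
    using ex_reduced_word[OF assms] by blast
  have "length xs = card (value_inversions w)" if "xs \<in> reduced_decompositions n w" for xs
  proof (rule antisym)
    have "zs \<in> decompositions n w" using zs by (simp add: decompositions_def reduced_word_def)
    then show "length xs \<le> card (value_inversions w)"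
      using that zs by (force simp: reduced_decompositions_def reduced_word_def)
    show "card (value_inversions w) \<le> length xs"
      using that card_value_inversions_le_length
      by (force simp: reduced_decompositions_def decompositions_def)
  qed
  moreover have "card (value_inversions w) \<le> length ys" if "ys \<in> decompositions n w" for ys
    using that card_value_inversions_le_length[of ys n] by (auto simp: decompositions_def)
  ultimately have "xs \<in> reduced_decompositions n w \<longleftrightarrow>
      xs \<in> decompositions n w \<and> length xs = card (value_inversions w)" for xs
    unfolding reduced_decompositions_def by fastforce
  then show ?thesis
    by (auto simp: decompositions_def reduced_word_def)
qed

section \<open>Commutation and braid moves at the end of a reduced word\<close>

lemma comp_adj_cancel:
  assumes "u \<circ> adj a = v \<circ> adj a"
  shows "u = v"
  using assms by (metis comp_assoc comp_id transpose_comp_involutory)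

text \<open>Distant descents can be undone in either order, so \<open>w\<close> has two reduced
  words that differ by a final commutation.\<close>

lemma far_descents:
  assumes w: "w permutes {1..n}" and a: "a \<in> {1..<n}" "w (Suc a) < w a"
    and b: "b \<in> {1..<n}" "w (Suc b) < w b" and far: "Suc a < b"
  shows "\<exists>zs. reduced_word n (zs @ [a, b]) \<and> apply_adj_transps (zs @ [a, b]) = w \<and>
    reduced_word n (zs @ [b, a]) \<and> apply_adj_transps (zs @ [b, a]) = w"
proof -
  have "w \<circ> adj a \<circ> adj b permutes {1..n}"
    by (intro permutes_comp_adj w a b)
  then obtain zs where zs: "reduced_word n zs" "apply_adj_transps zs = w \<circ> adj a \<circ> adj b"
    using ex_reduced_word by blast
  have s: "zs @ [x, y] = (zs @ [x]) @ [y]" for x y by simp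
  have "reduced_word n (zs @ [a, b])" "reduced_word n (zs @ [b, a])"
    unfolding s reduced_word_snoc using zs a b far
    by (auto simp: Transposition.transpose_def)
  moreover have "apply_adj_transps (zs @ [a, b]) = w" "apply_adj_transps (zs @ [b, a]) = w"
    unfolding s apply_adj_transps_snoc zs
    using far by (auto simp: fun_eq_iff Transposition.transpose_def)
  ultimately show ?thesis by blast
qed

text \<open>Three consecutive decreasing entries can be sorted by either side of the braid relation,
  which gives two reduced endings.\<close>

lemma adjacent_descents:
  assumes w: "w permutes {1..n}" and a: "a \<in> {1..<n}" "w (Suc a) < w a"
    and b: "Suc a \<in> {1..<n}" "w (Suc (Suc a)) < w (Suc a)"
  shows "\<exists>zs. reduced_word n (zs @ [a, Suc a, a]) \<and> apply_adj_transps (zs @ [a, Suc a, a]) = w \<and>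
    reduced_word n (zs @ [Suc a, a, Suc a]) \<and> apply_adj_transps (zs @ [Suc a, a, Suc a]) = w"
proof -
  have "w \<circ> adj a \<circ> adj (Suc a) \<circ> adj a permutes {1..n}"
    by (intro permutes_comp_adj w a b)
  then obtain zs where zs: "reduced_word n zs"
    "apply_adj_transps zs = w \<circ> adj a \<circ> adj (Suc a) \<circ> adj a"
    using ex_reduced_word by blast
  have s: "zs @ [x, y, z] = ((zs @ [x]) @ [y]) @ [z]" for x y z by simp
  have "reduced_word n (zs @ [a, Suc a, a])" "reduced_word n (zs @ [Suc a, a, Suc a])"
    unfolding s reduced_word_snoc apply_adj_transps_snoc zs(2) using zs(1) a b
    by (auto simp: Transposition.transpose_def)
  moreover have "apply_adj_transps (zs @ [a, Suc a, a]) = w" "apply_adj_transps (zs @ [Suc a, a, Suc a]) = w"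
    unfolding s apply_adj_transps_snoc zs
    by (auto simp: fun_eq_iff Transposition.transpose_def)
  ultimately show ?thesis by blast
qed

text \<open>The induction behind Matsumoto's theorem, stopped at the first braid move that involves \<open>k\<close>.\<close>

lemma count_differs_imp_braid:
  assumes "reduced_word n xs" "reduced_word n ys" "apply_adj_transps xs = apply_adj_transps ys"
    "count_list xs k \<noteq> count_list ys k"
  shows "\<exists>zs m us. reduced_word n (zs @ [m, Suc m, m] @ us) \<and>
    apply_adj_transps (zs @ [m, Suc m, m] @ us) = apply_adj_transps xs \<and> k \<in> {m, Suc m}"
  using assms
proof (induction "length xs" arbitrary: xs ys rule: less_induct)
  case less
  have len: "length xs = length ys"
    using less.prems by (simp add: reduced_word_def)
  moreover have "xs \<noteq> []" using less.prems(4) len by auto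
  ultimately obtain a b xs' ys' where xs: "xs = xs' @ [a]" and ys: "ys = ys' @ [b]"
    by (metis length_0_conv rev_exhaust)
  define w where "w = apply_adj_transps xs"
  have w: "w = apply_adj_transps xs' \<circ> adj a" "w = apply_adj_transps ys' \<circ> adj b"
    using w_def xs less.prems(3) ys by auto
  have w_apply: "w a = apply_adj_transps xs' (Suc a)" "w (Suc a) = apply_adj_transps xs' a"
    "w b = apply_adj_transps ys' (Suc b)" "w (Suc b) = apply_adj_transps ys' b"
    by (simp add: w(1), simp add: w(1), simp add: w(2), simp add: w(2))
  have xs': "reduced_word n xs'" and ys': "reduced_word n ys'"
    and a: "a \<in> {1..<n}" "w (Suc a) < w a" and b: "b \<in> {1..<n}" "w (Suc b) < w b"
    using less.prems(1,2) unfolding w_apply xs ys reduced_word_snoc by blast+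
  have wp: "w permutes {1..n}"
    using less.prems(1) word_permutes unfolding w_def reduced_word_def by blast
  \<comment> \<open>Words with the same last letter: the induction hypothesis applies to their
    prefixes, and the letter is put back at the end of \<open>us\<close>.\<close>
  have ext: ?case
    if r: "reduced_word n (vs @ [c])" "apply_adj_transps (vs @ [c]) = w"
      and r': "reduced_word n (vs' @ [c])" "apply_adj_transps (vs' @ [c]) = w"
      and l: "length vs < length xs" and d: "count_list vs k \<noteq> count_list vs' k" for vs vs' c
  proof -
    have eq: "apply_adj_transps vs = apply_adj_transps vs'"
      using r(2) r'(2) unfolding apply_adj_transps_snoc Suc_eq_plus1[symmetric]
      by (metis comp_adj_cancel)
    have "reduced_word n vs" "reduced_word n vs'" using r r' by (simp_all add: reduced_word_snoc)
    from less.hyps[OF l this eq d] obtain zs m us where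
      *: "reduced_word n (zs @ [m, Suc m, m] @ us)"
        "apply_adj_transps (zs @ [m, Suc m, m] @ us) = apply_adj_transps vs" "k \<in> {m, Suc m}"
      by blast
    have "reduced_word n ((zs @ [m, Suc m, m] @ us) @ [c])"
      unfolding reduced_word_snoc *(2) using *(1) r(1) by (simp add: reduced_word_snoc)
    moreover have "apply_adj_transps ((zs @ [m, Suc m, m] @ us) @ [c]) = w"
      unfolding apply_adj_transps_snoc *(2) using r(2) unfolding apply_adj_transps_snoc .
    ultimately show ?thesis
      using *(3) unfolding append_assoc w_def by blast
  qed
  have X: "reduced_word n (xs' @ [a])" "apply_adj_transps (xs' @ [a]) = w"
    and Y: "reduced_word n (ys' @ [b])" "apply_adj_transps (ys' @ [b]) = w"
    using less.prems xs ys w_def by auto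
  have lens: "length xs' < length xs" "length ys' < length xs" using xs ys len by auto
  \<comment> \<open>An intermediate pair with equal counts splits the comparison of
    \<open>xs\<close> and \<open>ys\<close> into two, each between words with a common last letter;
    one of the two still shows different counts.\<close>
  have ext2: ?case
    if r: "reduced_word n (vs @ [a])" "apply_adj_transps (vs @ [a]) = w"
      "reduced_word n (vs' @ [b])" "apply_adj_transps (vs' @ [b]) = w"
      and d: "count_list (vs @ [a]) k = count_list (vs' @ [b]) k" for vs vs'
  proof (cases "count_list xs' k = count_list vs k")
    case True
    then have "count_list ys' k \<noteq> count_list vs' k"
      using d less.prems(4) xs ys by auto
    then show ?thesis using ext[OF Y r(3,4) lens(2)] by blast
  next
    case False
    then show ?thesis using ext[OF X r(1,2) lens(1)] by blast
  qed
  \<comment> \<open>A braid move with \<open>k\<close> among its letters is the one sought, with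
    \<open>us\<close> empty; any other leaves the count of \<open>k\<close> unchanged.\<close>
  have adjcase: ?case
    if r: "reduced_word n (zs @ [m, Suc m, m])" "apply_adj_transps (zs @ [m, Suc m, m]) = w"
      "reduced_word n (zs @ [Suc m, m, Suc m])" "apply_adj_transps (zs @ [Suc m, m, Suc m]) = w"
      and ab: "a = m \<and> b = Suc m \<or> b = m \<and> a = Suc m" for zs m
  proof (cases "k \<in> {m, Suc m}")
    case True
    then show ?thesis
      using r(1,2) unfolding w_def by (metis append_Nil2)
  next
    case False
    then show ?thesis
      using ab ext2[of "zs @ [m, Suc m]" "zs @ [Suc m, m]"]
        ext2[of "zs @ [Suc m, m]" "zs @ [m, Suc m]"] r by auto
  qed
  consider "a = b" | "b = Suc a" | "a = Suc b" | "Suc a < b" | "Suc b < a" by linarith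
  then show ?case
  proof cases
    case 1
    then show ?thesis using ext[OF X _ _ lens(1), of ys'] Y less.prems(4) xs ys by auto
  next
    case 2
    then show ?thesis using adjacent_descents[OF wp a] b adjcase by blast
  next
    case 3
    then show ?thesis using adjacent_descents[OF wp b] a adjcase by blast
  next
    case 4
    from far_descents[OF wp a b 4] obtain zs where
      "reduced_word n (zs @ [a, b])" "apply_adj_transps (zs @ [a, b]) = w"
      "reduced_word n (zs @ [b, a])" "apply_adj_transps (zs @ [b, a]) = w" by blast
    then show ?thesis using ext2[of "zs @ [b]" "zs @ [a]"] by simp
  next
    case 5
    from far_descents[OF wp b a 5] obtain zs where
      "reduced_word n (zs @ [a, b])" "apply_adj_transps (zs @ [a, b]) = w"
      "reduced_word n (zs @ [b, a])" "apply_adj_transps (zs @ [b, a]) = w" by blast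
    then show ?thesis using ext2[of "zs @ [b]" "zs @ [a]"] by simp
  qed
qed

subsection \<open>Braid moves and antichains\<close>

lemma min_occ_less_max_occ_iff:
  assumes "w permutes {1..n}"
  shows "min_occ n k w < max_occ n k w \<longleftrightarrow>
    (\<exists>xs \<in> reduced_decompositions n w. \<exists>ys \<in> reduced_decompositions n w.
      count_list xs k \<noteq> count_list ys k)"
proof -
  let ?R = "reduced_decompositions n w"
  let ?C = "(\<lambda>xs. count_list xs k) ` ?R"
  have C: "finite ?C" "?C \<noteq> {}"
    using finite_reduced_decompositions reduced_decompositions_nonempty[OF assms] by auto
  show ?thesis
  proof
    assume "min_occ n k w < max_occ n k w"
    then show "\<exists>xs\<in>?R. \<exists>ys\<in>?R. count_list xs k \<noteq> count_list ys k"
      using Min_in[OF C] Max_in[OF C] unfolding min_occ_def max_occ_def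
      by (metis (no_types, lifting) imageE less_irrefl)
  next
    assume "\<exists>xs\<in>?R. \<exists>ys\<in>?R. count_list xs k \<noteq> count_list ys k"
    then obtain c d where "c \<in> ?C" "d \<in> ?C" "c < d" by (metis imageI linorder_neqE_nat)
    then show "min_occ n k w < max_occ n k w"
      using Min_le[OF C(1)] Max_ge[OF C(1)] unfolding min_occ_def max_occ_def
      by (meson le_less_trans less_le_trans)
  qed
qed

text \<open>For an antichain \<open>T\<close> this is the order ideal that \<open>T\<close>
  generates, without \<open>T\<close> itself; \<open>strictly_above\<close> is the dual.\<close>

definition strictly_below :: "nat \<Rightarrow> (nat \<Rightarrow> nat) \<Rightarrow> nat set \<Rightarrow> nat set" where
  "strictly_below n w T = {q \<in> {1..n}. \<exists>t\<in>T. q < t \<and> w q < w t}"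

definition strictly_above :: "nat \<Rightarrow> (nat \<Rightarrow> nat) \<Rightarrow> nat set \<Rightarrow> nat set" where
  "strictly_above n w T = {q \<in> {1..n}. \<exists>t\<in>T. t < q \<and> w t < w q}"

text \<open>The bounds cover \<open>m = k\<close> and \<open>m = k - 1\<close> at once: exactly
  \<open>k - 1\<close> positions below force \<open>m = k\<close>, and exactly
  \<open>n - k - 1\<close> positions above force \<open>m = k - 1\<close>.\<close>

definition braid_triple :: "nat \<Rightarrow> (nat \<Rightarrow> nat) \<Rightarrow> nat \<Rightarrow> nat \<Rightarrow> nat \<Rightarrow> nat \<Rightarrow> bool" where
  "braid_triple n w k i p j \<longleftrightarrow>
     {i, p, j} \<subseteq> {1..n} \<and> i < p \<and> p < j \<and> w p < w i \<and> w j < w p \<and>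
     card (strictly_below n w {i, p, j}) < k \<and> card (strictly_above n w {i, p, j}) + k < n"

text \<open>The braid acts on the places \<open>m\<close>, \<open>m + 1\<close>,
  \<open>m + 2\<close>; anything strictly below one of the three entries must already be listed
  before place \<open>m\<close>, and anything strictly above one of them can only be listed after
  place \<open>m + 2\<close>.\<close>

lemma reduced_braid_imp_braid_triple:
  assumes red: "reduced_word n (zs @ [m, Suc m, m] @ us)"
    and w: "apply_adj_transps (zs @ [m, Suc m, m] @ us) = w" and k: "k \<in> {m, Suc m}"
  shows "\<exists>i p j. braid_triple n w k i p j"
proof -
  define u where "u = apply_adj_transps zs"
  define v where "v = apply_adj_transps (zs @ [m, Suc m, m])"
  have wp: "w permutes {1..n}"
    using red word_permutes unfolding w[symmetric] reduced_word_def by blast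
  have redv: "reduced_word n (zs @ [m, Suc m, m])" and vw: "value_inversions v \<subseteq> value_inversions w"
    using reduced_word_prefix[of n "zs @ [m, Suc m, m]" us] red w by (simp_all add: v_def)
  have redu: "reduced_word n zs" and uw: "value_inversions u \<subseteq> value_inversions w"
    using reduced_word_prefix[of n zs "[m, Suc m, m] @ us"] red w by (simp_all add: u_def)
  have up: "u permutes {1..n}" and vp: "v permutes {1..n}"
    using redu redv word_permutes unfolding u_def v_def reduced_word_def by blast+
  have bu: "bij u" and bv: "bij v" and bw: "bij w" using up vp wp permutes_bij by auto
  have m: "m \<ge> 1" "m + 2 \<le> n" using red by (auto simp: reduced_word_def)
  have s1: "zs @ [m, Suc m, m] = ((zs @ [m]) @ [Suc m]) @ [m]" by simp
  have v: "v = u \<circ> adj m \<circ> adj (Suc m) \<circ> adj m"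
    unfolding v_def s1 apply_adj_transps_snoc u_def by simp
  have vval: "v m = u (m + 2)" "v (m + 1) = u (m + 1)" "v (m + 2) = u m"
    unfolding v by (simp_all add: Transposition.transpose_def)
  have asc: "u m < u (m + 1)" "u m < u (m + 2)" "u (m + 1) < u (m + 2)"
    using redv unfolding s1 reduced_word_snoc apply_adj_transps_snoc u_def[symmetric]
    by (auto simp: Transposition.transpose_def)
  \<comment> \<open>\<open>pos r\<close> is the position in \<open>w\<close> of the value that
    \<open>u\<close> has at place \<open>r\<close>.\<close>
  define pos where "pos = inv w \<circ> u"
  have w_pos: "w (pos r) = u r" for r
    using bw by (simp add: pos_def bij_is_surj surj_f_inv_f)
  have pos_perm: "pos permutes {1..n}"
    unfolding pos_def using permutes_compose[OF up permutes_inv[OF wp]] .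
  have pos_surj: "\<exists>r \<in> {1..n}. q = pos r" if "q \<in> {1..n}" for q
    using that permutes_image[OF pos_perm] by (metis imageE)
  \<comment> \<open>Read contrapositively: \<open>u\<close> lists the positions of \<open>w\<close>
    along a linear extension of the product order of position and value.\<close>
  have sub_u: "r < s \<Longrightarrow> u s < u r \<Longrightarrow> pos r < pos s" for r s
    using uw mem_value_inversions_iff[OF bu, of s r] mem_value_inversions_iff[OF bw, of "pos s" "pos r"]
    by (auto simp: w_pos)
  have sub_v: "r < s \<Longrightarrow> v s < v r \<Longrightarrow> inv w (v r) < inv w (v s)" for r s
    using vw mem_value_inversions_iff[OF bv, of s r] by (auto simp: value_inversions_def)
  \<comment> \<open>The three inversions created by the braid survive in \<open>w\<close>, so these
    entries decrease there.\<close>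
  have order: "pos (m + 2) < pos (m + 1)" "pos (m + 1) < pos m" "pos (m + 2) < pos m"
    using sub_v[of m "m + 1"] sub_v[of "m + 1" "m + 2"] sub_v[of m "m + 2"] asc vval
    by (simp_all add: pos_def)
  let ?T = "{pos (m + 2), pos (m + 1), pos m}"
  have triple: "t \<in> ?T \<longleftrightarrow> (\<exists>s. t = pos s \<and> m \<le> s \<and> s \<le> m + 2)" for t
  proof -
    have "m \<le> s \<and> s \<le> m + 2 \<longleftrightarrow> s = m \<or> s = m + 1 \<or> s = m + 2" for s by arith
    then show ?thesis by auto
  qed
  have no_chain: "\<not> (pos r < pos s \<and> u r < u s)" if "m \<le> r" "r \<le> m + 2" "m \<le> s" "s \<le> m + 2" for r s
  proof -
    have "r = m \<or> r = m + 1 \<or> r = m + 2" "s = m \<or> s = m + 1 \<or> s = m + 2" using that by arith+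
    then show ?thesis using order asc by auto
  qed
  have "strictly_below n w ?T \<subseteq> pos ` {1..<m}"
  proof
    fix q assume "q \<in> strictly_below n w ?T"
    then obtain t where q: "q \<in> {1..n}" and t: "t \<in> ?T" "q < t" "w q < w t"
      unfolding strictly_below_def by blast
    from t(1) obtain s where s: "t = pos s" "m \<le> s" "s \<le> m + 2" using triple by blast
    obtain r where r: "q = pos r" "r \<in> {1..n}" using pos_surj[OF q] by blast
    have lt: "pos r < pos s" "u r < u s" using t r s by (simp_all add: w_pos)
    then have "\<not> s < r" using sub_u[of s r] by auto
    then have "r < m" using no_chain[of r s] lt s by (cases "m \<le> r") auto
    then show "q \<in> pos ` {1..<m}" using r by auto
  qed
  then have "card (strictly_below n w ?T) \<le> card {1..<m}"
    by (meson card_image_le card_mono finite_atLeastLessThan finite_imageI le_trans)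
  moreover have "strictly_above n w ?T \<subseteq> pos ` {m + 3..n}"
  proof
    fix q assume "q \<in> strictly_above n w ?T"
    then obtain t where q: "q \<in> {1..n}" and t: "t \<in> ?T" "t < q" "w t < w q"
      unfolding strictly_above_def by blast
    from t(1) obtain s where s: "t = pos s" "m \<le> s" "s \<le> m + 2" using triple by blast
    obtain r where r: "q = pos r" "r \<in> {1..n}" using pos_surj[OF q] by blast
    have lt: "pos s < pos r" "u s < u r" using t r s by (simp_all add: w_pos)
    then have "\<not> r < s" using sub_u[of r s] by auto
    then have "m + 2 < r" using no_chain[of s r] lt s by (cases "r \<le> m + 2") auto
    then show "q \<in> pos ` {m + 3..n}" using r by auto
  qed
  then have "card (strictly_above n w ?T) \<le> card {m + 3..n}"
    by (meson card_image_le card_mono finite_atLeastAtMost finite_imageI le_trans)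
  moreover have "?T \<subseteq> {1..n}"
    using m permutes_in_image[OF pos_perm] by auto
  \<comment> \<open>At most \<open>m - 1\<close> positions lie below and at most
    \<open>n - m - 2\<close> above, which meets both bounds for \<open>k = m\<close> and for
    \<open>k = m + 1\<close>.\<close>
  ultimately have "braid_triple n w k (pos (m + 2)) (pos (m + 1)) (pos m)"
    using k m order asc unfolding braid_triple_def by (auto simp: w_pos)
  then show ?thesis by blast
qed

section \<open>Order ideals and the construction of a braid move from an antichain\<close>

definition order_ideal :: "nat \<Rightarrow> (nat \<Rightarrow> nat) \<Rightarrow> nat set \<Rightarrow> bool" where
  "order_ideal n w A \<longleftrightarrow>
     A \<subseteq> {1..n} \<and> (\<forall>q\<in>A. \<forall>q'\<in>{1..n}. q' < q \<longrightarrow> w q' < w q \<longrightarrow> q' \<in> A)"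

text \<open>Ideals can be enlarged one position at a time: whatever lies below a remaining position
  of least value is already present.\<close>

lemma order_ideal_between:
  assumes "order_ideal n w A\<^sub>0" "order_ideal n w A\<^sub>1" "A\<^sub>0 \<subseteq> A\<^sub>1" "card A\<^sub>0 \<le> s" "s \<le> card A\<^sub>1"
  shows "\<exists>A. order_ideal n w A \<and> A\<^sub>0 \<subseteq> A \<and> A \<subseteq> A\<^sub>1 \<and> card A = s"
  using assms(4,5)
proof (induction s rule: dec_induct)
  case base
  then show ?case using assms by blast
next
  case (step s)
  then obtain A where A: "order_ideal n w A" "A\<^sub>0 \<subseteq> A" "A \<subseteq> A\<^sub>1" "card A = s" by auto
  have fin: "finite A\<^sub>1" "finite A"
    using assms(2) A(1) by (auto simp: order_ideal_def intro: finite_subset)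
  have "A\<^sub>1 - A \<noteq> {}"
    using A step.prems fin by (metis Diff_eq_empty_iff Suc_n_not_le_n card_mono le_trans)
  then obtain q where q: "q \<in> A\<^sub>1 - A" "\<And>r. r \<in> A\<^sub>1 - A \<Longrightarrow> w q \<le> w r"
    using fin by (metis arg_min_if_finite(1) arg_min_least finite_Diff)
  have "order_ideal n w (insert q A)"
    using q A(1) assms(2) unfolding order_ideal_def
    by (metis (no_types, lifting) DiffD1 DiffI insert_iff insert_subset leD subsetD)
  then show ?case
    using A q fin by (intro exI[of _ "insert q A"]) auto
qed

text \<open>\<open>u\<close> lists the values of the ideal \<open>A\<close> increasingly, then those of the antichain, then all others.\<close>

lemma ideal_arrangement:
  assumes w: "w permutes {1..n}" and A: "order_ideal n w A"
    and T: "i < p" "p < j" "w p < w i" "w j < w p" "{i, p, j} \<subseteq> {1..n}" "{i, p, j} \<inter> A = {}"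
    and below: "strictly_below n w {i, p, j} \<subseteq> A"
  shows "\<exists>u. u permutes {1..n} \<and> value_inversions u \<subseteq> value_inversions w \<and>
    u (card A + 1) = w j \<and> u (card A + 2) = w p \<and> u (card A + 3) = w i"
proof -
  define B where "B = {1..n} - A - {i, p, j}"
  define l where "l = sorted_list_of_set (w ` A) @ [w j, w p, w i] @ sorted_list_of_set (w ` B)"
  have wi: "inj w" using w by (rule permutes_inj)
  have finA: "finite A" "A \<subseteq> {1..n}" using A by (auto simp: order_ideal_def intro: finite_subset)
  have finB: "finite B" "B \<subseteq> {1..n}" by (auto simp: B_def)
  have part: "A \<union> {i, p, j} \<union> B = {1..n}" using finA T(5) by (auto simp: B_def)
  have set_l: "set l = {1..n}"
  proof -
    have "set l = w ` (A \<union> {i, p, j} \<union> B)" using finA finB by (auto simp: l_def)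
    then show ?thesis unfolding part permutes_image[OF w] .
  qed
  have dist: "distinct l"
    using finA finB T(1-4,6) wi by (auto simp: l_def B_def inj_eq)
  have len: "length l = n" using distinct_card[OF dist] set_l by simp
  \<comment> \<open>\<open>R y x\<close> says that listing \<open>y\<close> before \<open>x\<close>
    is harmless: either they are in increasing order, or \<open>y\<close> precedes \<open>x\<close>
    in \<open>w\<close> as well. A list sorted by \<open>R\<close> therefore has no inversion that
    \<open>w\<close> lacks.\<close>
  define R where "R = (\<lambda>y x. y < x \<or> inv w y < inv w x)"
  have blocks: "sorted_wrt R (sorted_list_of_set S)" for S
    using strict_sorted_list_of_set[of S] sorted_wrt_mono_rel[of _ "(<)" R] by (auto simp: R_def)
  have R_w: "R (w b) (w a) \<longleftrightarrow> w b < w a \<or> b < a" for a b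
    by (simp add: R_def wi)
  \<comment> \<open>No position outside the ideal is strictly below one inside, and none in
    \<open>B\<close> is strictly below the antichain.\<close>
  have cross1: "R (w b) (w a)" if "b \<in> A" "a \<in> {1..n}" "a \<notin> A" for a b
    using that A unfolding R_w order_ideal_def by (metis inj_eq linorder_neqE_nat wi)
  have cross2: "R (w b) (w a)" if "b \<in> {i, p, j}" "a \<in> B" for a b
  proof (rule ccontr)
    assume "\<not> R (w b) (w a)"
    moreover have "a \<noteq> b" using that by (auto simp: B_def)
    ultimately have "a < b" "w a < w b" unfolding R_w using wi by (auto simp: inj_eq not_less order_le_less)
    then have "a \<in> strictly_below n w {i, p, j}"
      using that finB unfolding strictly_below_def by blast
    then show False using below that by (auto simp: B_def)
  qed
  have "sorted_wrt R ([w j, w p, w i] @ sorted_list_of_set (w ` B))"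
    unfolding sorted_wrt_append using blocks cross2 finB T(3,4) by (auto simp: R_def)
  then have sorted: "sorted_wrt R l"
    unfolding l_def sorted_wrt_append[of R "sorted_list_of_set (w ` A)"]
    using blocks cross1 finA finB T(5,6) by (auto simp: B_def)
  \<comment> \<open>List indices start at \<open>0\<close>, positions at \<open>1\<close>.\<close>
  define u where "u q = (if q \<in> {1..n} then l ! (q - 1) else q)" for q
  have "bij_betw (\<lambda>q. q - 1) {1..n} {..<length l}"
    by (rule bij_betwI[of _ _ _ Suc]) (auto simp: len)
  then have "bij_betw ((!) l \<circ> (\<lambda>q. q - 1)) {1..n} {1..n}"
    using bij_betw_nth[OF dist refl refl] set_l by (metis bij_betw_trans)
  moreover have "((!) l \<circ> (\<lambda>q. q - 1)) q = u q" if "q \<in> {1..n}" for q using that by (simp add: u_def)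
  ultimately have "bij_betw u {1..n} {1..n}" using bij_betw_cong by blast
  then have up: "u permutes {1..n}"
    by (rule bij_imp_permutes) (auto simp: u_def)
  have "(x, y) \<in> value_inversions w" if xy: "(x, y) \<in> value_inversions u" for x y
  proof -
    have lt: "x < y" "inv u y < inv u x" using xy by (auto simp: value_inversions_def)
    have "inv u x \<in> {1..n} \<and> inv u y \<in> {1..n}"
      using value_inversions_subset[OF up] xy permutes_in_image[OF permutes_inv[OF up]] by blast
    then have "R (l ! (inv u y - 1)) (l ! (inv u x - 1))"
      using sorted_wrt_nth_less[OF sorted, of "inv u y - 1" "inv u x - 1"] lt len by auto
    moreover have "l ! (inv u z - 1) = z" if "inv u z \<in> {1..n}" for z
      using that permutes_inverses(1)[OF up, of z] by (simp add: u_def)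
    ultimately have "R y x" using \<open>inv u x \<in> {1..n} \<and> inv u y \<in> {1..n}\<close> by simp
    then show ?thesis using lt by (auto simp: R_def value_inversions_def)
  qed
  moreover have cA: "length (sorted_list_of_set (w ` A)) = card A"
    using card_image[of w A] wi by (simp add: inj_on_subset)
  have "card A + 3 \<le> n" using len cA by (simp add: l_def)
  then have "u (card A + 1) = w j" "u (card A + 2) = w p" "u (card A + 3) = w i"
    using cA by (simp_all add: u_def l_def nth_append)
  ultimately show ?thesis using up by auto
qed

text \<open>After a suitable ideal and the antichain are listed, both sides of a braid relation
  reverse the antichain. The result is still below \<open>w\<close> in the weak order, so both words
  extend to \<open>w\<close> by the same suffix.\<close>

lemma braid_triple_imp_count_differs:
  assumes w: "w permutes {1..n}" and tr: "braid_triple n w k i p j"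
  shows "\<exists>xs ys. reduced_word n xs \<and> apply_adj_transps xs = w \<and>
    reduced_word n ys \<and> apply_adj_transps ys = w \<and> count_list xs k \<noteq> count_list ys k"
proof -
  let ?T = "{i, p, j}"
  let ?D = "strictly_below n w ?T"
  let ?U = "strictly_above n w ?T"
  \<comment> \<open>The largest ideal that avoids the antichain.\<close>
  let ?A = "{1..n} - ?U - ?T"
  have T: "i < p" "p < j" "w p < w i" "w j < w p" "?T \<subseteq> {1..n}" and D: "card ?D < k" and U: "card ?U + k < n"
    using tr by (auto simp: braid_triple_def)
  have anti: "\<not> (t < t' \<and> w t < w t')" if "t \<in> ?T" "t' \<in> ?T" for t t'
    using that T by auto
  have UT: "?U \<inter> ?T = {}" using anti unfolding strictly_above_def by blast
  have Un: "?U \<subseteq> {1..n}" by (auto simp: strictly_above_def)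
  have "card ?T = 3" using T by simp
  then have "card (?U \<union> ?T) = card ?U + 3"
    using card_Un_disjoint[OF _ _ UT] finite_subset[OF Un] by simp
  moreover have "?A = {1..n} - (?U \<union> ?T)" by blast
  ultimately have cA: "card ?A = n - (card ?U + 3)" "card ?U + 3 \<le> n"
    using card_Diff_subset[of "?U \<union> ?T" "{1..n}"] card_mono[of "{1..n}" "?U \<union> ?T"] Un T(5)
    by (auto simp: finite_subset[OF Un])
  have oD: "order_ideal n w ?D"
    unfolding order_ideal_def strictly_below_def by fastforce
  have oA: "order_ideal n w ?A"
    unfolding order_ideal_def
  proof (intro conjI ballI impI)
    fix q q' assume q: "q \<in> ?A" and q': "q' \<in> {1..n}" "q' < q" "w q' < w q"
    have "q' \<notin> ?T"
    proof
      assume "q' \<in> ?T"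
      then have "q \<in> ?U" using q q' unfolding strictly_above_def by blast
      then show False using q by blast
    qed
    moreover have "q' \<notin> ?U"
    proof
      assume "q' \<in> ?U"
      then obtain t where "t \<in> ?T" "t < q'" "w t < w q'" unfolding strictly_above_def by blast
      then have "q \<in> ?U" using q q' unfolding strictly_above_def
        by (metis (mono_tags, lifting) DiffD1 less_trans mem_Collect_eq)
      then show False using q by blast
    qed
    ultimately show "q' \<in> ?A" using q' by blast
  qed blast
  have DA: "?D \<subseteq> ?A"
  proof
    fix q assume "q \<in> ?D"
    then obtain t where q: "q \<in> {1..n}" "t \<in> ?T" "q < t" "w q < w t"
      unfolding strictly_below_def by blast
    have "q \<notin> ?T" using q anti by blast
    moreover have "q \<notin> ?U"
    proof
      assume "q \<in> ?U"
      then obtain t' where "t' \<in> ?T" "t' < q" "w t' < w q" unfolding strictly_above_def by blast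
      then show False using q anti[of t' t] by (meson less_trans)
    qed
    ultimately show "q \<in> ?A" using q by blast
  qed
  \<comment> \<open>By the bound on \<open>?U\<close>, \<open>card ?A\<close> is at least
    \<open>k - 2\<close>, so \<open>s\<close> is \<open>k - 1\<close> or \<open>k - 2\<close>, and
    \<open>k\<close> is \<open>m\<close> or \<open>Suc m\<close> below.\<close>
  define s where "s = min (k - 1) (card ?A)"
  have "card ?D \<le> s" using D card_mono[OF _ DA] by (simp add: s_def)
  then obtain A where A: "order_ideal n w A" "?D \<subseteq> A" "A \<subseteq> ?A" "card A = s"
    using order_ideal_between[OF oD oA DA, of s] unfolding s_def by (meson min.cobounded2)
  define m where "m = s + 1"
  have m: "k \<in> {m, Suc m}" "m + 2 \<le> n"
    using D U cA by (auto simp: m_def s_def)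
  have "?T \<inter> A = {}" using A(3) by blast
  from ideal_arrangement[OF w A(1) T this A(2)] obtain u where u: "u permutes {1..n}"
    "value_inversions u \<subseteq> value_inversions w" and uval: "u m = w j" "u (Suc m) = w p" "u (Suc (Suc m)) = w i"
    unfolding A(4) m_def by (auto simp: numeral_eq_Suc)
  obtain zs where zs: "reduced_word n zs" "apply_adj_transps zs = u"
    using ex_reduced_word[OF u(1)] by blast
  have bw: "bij w" using w by (rule permutes_bij)
  let ?v = "u \<circ> adj m \<circ> adj (Suc m) \<circ> adj m"
  have "bij u" "bij (u \<circ> adj m)" "bij (u \<circ> adj m \<circ> adj (Suc m))"
    using permutes_bij[OF u(1)] by (simp_all add: bij_comp)
  \<comment> \<open>The three exchanges reverse the antichain and add just its three inversions,
    which \<open>w\<close> has as well.\<close>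
  then have "value_inversions ?v = {(w j, w p), (w j, w i), (w p, w i)} \<union> value_inversions u"
    using T(3,4) uval by (simp add: value_inversions_ascent Transposition.transpose_def)
      (auto simp: Transposition.transpose_def uval)
  then have vw: "value_inversions ?v \<subseteq> value_inversions w"
    using u(2) T(1-4) mem_value_inversions_iff[OF bw] by auto
  have m_in: "m \<in> {1..<n}" "Suc m \<in> {1..<n}" using m(2) by (auto simp: m_def)
  have s3: "zs @ [x, y, z] = ((zs @ [x]) @ [y]) @ [z]" for x y z by simp
  have red1: "reduced_word n (zs @ [m, Suc m, m])" and red2: "reduced_word n (zs @ [Suc m, m, Suc m])"
    unfolding s3 reduced_word_snoc apply_adj_transps_snoc zs(2)
    using m_in zs(1) T(3,4) uval by (auto simp: Transposition.transpose_def)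
  have v1: "apply_adj_transps (zs @ [m, Suc m, m]) = ?v"
    unfolding s3 apply_adj_transps_snoc zs(2) by simp
  have v2: "apply_adj_transps (zs @ [Suc m, m, Suc m]) = ?v"
    unfolding s3 apply_adj_transps_snoc zs(2) by (auto simp: fun_eq_iff Transposition.transpose_def)
  have "?v permutes {1..n}" by (intro permutes_comp_adj u m_in)
  from weak_order_word[OF this w vw] obtain us where us: "set us \<subseteq> {1..<n}"
    "w = ?v \<circ> apply_adj_transps us" "card (value_inversions ?v) + length us = card (value_inversions w)"
    by blast
  have ext: "reduced_word n (vs @ us) \<and> apply_adj_transps (vs @ us) = w"
    if "reduced_word n vs" "apply_adj_transps vs = ?v" for vs
  proof -
    have *: "apply_adj_transps (vs @ us) = w"
      unfolding apply_adj_transps_append that(2) us(2) ..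
    then show ?thesis
      using that us unfolding reduced_word_def by simp
  qed
  \<comment> \<open>Each of \<open>m\<close> and \<open>Suc m\<close> occurs twice in one braid word
    and once in the other.\<close>
  have "count_list ((zs @ [m, Suc m, m]) @ us) k \<noteq> count_list ((zs @ [Suc m, m, Suc m]) @ us) k"
    using m(1) by auto
  then show ?thesis using ext[OF red1 v1] ext[OF red2 v2] by blast
qed

subsection \<open>Balancing the two sides of the cut\<close>

text \<open>Elements join the chain in order of \<open>val\<close>. As long as no element of
  \<open>T\<close> precedes a chain member and has larger \<open>val\<close>, the remaining element
  of least \<open>val\<close> comes after the whole chain. Abstract \<open>pos\<close> and
  \<open>val\<close> serve both sides of the cut, with signs reversed on the left.\<close>

lemma initial_chain:
  fixes pos val :: "'a \<Rightarrow> int"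
  assumes "finite T" "inj_on pos T" "inj_on val T" "s \<le> card T"
  shows "\<exists>C\<subseteq>T. card C \<le> s \<and>
    (\<forall>c\<in>C. \<forall>t\<in>T. pos t < pos c \<and> val t < val c \<longrightarrow> t \<in> C) \<and>
    (\<forall>c\<in>C. \<forall>d\<in>C. pos c < pos d \<longleftrightarrow> val c < val d) \<and>
    (card C = s \<or> (\<exists>c\<in>C. \<exists>t\<in>T. pos t < pos c \<and> val c < val t))"
proof -
  define chain where "chain C \<longleftrightarrow> C \<subseteq> T \<and> (\<forall>c\<in>C. \<forall>t\<in>T. val t < val c \<longrightarrow> t \<in> C) \<and>
    (\<forall>c\<in>C. \<forall>d\<in>C. pos c < pos d \<longleftrightarrow> val c < val d)" for C
  have "\<exists>C. chain C \<and> card C \<le> s \<and>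
      (card C = s \<or> (\<exists>c\<in>C. \<exists>t\<in>T. pos t < pos c \<and> val c < val t))"
    using assms(4)
  proof (induction s)
    case 0
    then show ?case by (intro exI[of _ "{}"]) (simp add: chain_def)
  next
    case (Suc s)
    then obtain C where C: "chain C" "card C \<le> s"
      "card C = s \<or> (\<exists>c\<in>C. \<exists>t\<in>T. pos t < pos c \<and> val c < val t)" by auto
    show ?case
    proof (cases "\<exists>c\<in>C. \<exists>t\<in>T. pos t < pos c \<and> val c < val t")
      case True
      then show ?thesis using C by auto
    next
      case False
      then have card: "card C = s" using C by auto
      have sub: "C \<subseteq> T" using C(1) by (simp add: chain_def)
      have "T - C \<noteq> {}"
        using card Suc.prems sub by auto
      then obtain t where t: "t \<in> T - C" "\<And>r. r \<in> T - C \<Longrightarrow> val t \<le> val r"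
        using assms(1) by (metis arg_min_if_finite(1) arg_min_least finite_Diff)
      have later: "val c < val t" "pos c < pos t" if "c \<in> C" for c
      proof -
        have "c \<noteq> t" "c \<in> T" using that t sub by auto
        then have "val c \<noteq> val t" "pos c \<noteq> pos t"
          using assms(2,3) t(1) by (auto simp: inj_on_def)
        moreover have "\<not> val t < val c" using C(1) that t(1) by (auto simp: chain_def)
        ultimately show "val c < val t" by simp
        then show "pos c < pos t" using False that t(1) \<open>pos c \<noteq> pos t\<close> by force
      qed
      have "chain (insert t C)"
        using C(1) t later unfolding chain_def
        by (smt (verit, best) DiffD1 DiffI insert_iff insert_subset)
      moreover have "card (insert t C) = Suc s"
        using card t(1) finite_subset[OF sub assms(1)] by simp
      ultimately show ?thesis by (intro exI[of _ "insert t C"]) simp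
    qed
  qed
  then show ?thesis unfolding chain_def by blast
qed

lemma ex_rank:
  fixes pos :: "'a \<Rightarrow> int"
  assumes "finite C" "inj_on pos C" "r < card C"
  shows "\<exists>c\<in>C. card {d \<in> C. pos d < pos c} = r"
  using assms
proof (induction "card C" arbitrary: C)
  case (Suc m)
  have "C \<noteq> {}" using Suc.prems by auto
  then have "Max (pos ` C) \<in> pos ` C" using Suc.prems(1) by simp
  then obtain c where "c \<in> C" "pos c = Max (pos ` C)" by auto
  then have c: "c \<in> C" "\<And>d. d \<in> C \<Longrightarrow> pos d \<le> pos c"
    using Suc.prems(1) by simp_all
  have below: "{d \<in> C. pos d < pos c} = C - {c}"
    using c Suc.prems(2) by (force simp: inj_on_def order_less_le)
  have card: "card (C - {c}) = m" using Suc.hyps(2) Suc.prems(1) c(1) by simp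
  show ?case
  proof (cases "r = m")
    case True
    then show ?thesis using c(1) below card by metis
  next
    case False
    then have "r < card (C - {c})" using Suc.prems Suc.hyps(2) card by simp
    with Suc.hyps(1)[of "C - {c}"] obtain e where
      e: "e \<in> C - {c}" "card {d \<in> C - {c}. pos d < pos e} = r"
      using Suc.prems card by (auto simp: inj_on_diff)
    moreover have "{d \<in> C - {c}. pos d < pos e} = {d \<in> C. pos d < pos e}"
      using c(2)[of e] e(1) by auto
    ultimately show ?thesis by auto
  qed
qed simp

section \<open>Chains on the two sides of the cut\<close>

definition L_pos :: "(nat \<Rightarrow> nat) \<Rightarrow> nat \<Rightarrow> nat \<Rightarrow> nat set" where
  "L_pos w k i = {q. i < q \<and> q \<le> k \<and> w i < w q}"

definition R_pos :: "(nat \<Rightarrow> nat) \<Rightarrow> nat \<Rightarrow> nat \<Rightarrow> nat set" where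
  "R_pos w k j = {q. k < q \<and> q < j \<and> w q < w j}"

lemma finite_L_pos [simp]: "finite (L_pos w k i)"
  by (rule finite_subset[of _ "{..k}"]) (auto simp: L_pos_def)

lemma finite_R_pos [simp]: "finite (R_pos w k j)"
  by (rule finite_subset[of _ "{..j}"]) (auto simp: R_pos_def)

lemma L_set_eq: "L_set w k i = w ` L_pos w k i"
  by (auto simp: L_set_def L_pos_def)

lemma R_set_eq: "R_set w k j = w ` R_pos w k j"
  by (auto simp: R_set_def R_pos_def)

lemma appear_increasing_image:
  assumes "inj w"
  shows "appear_increasing w (w ` S) \<longleftrightarrow> strict_mono_on S w"
  using assms by (simp add: appear_increasing_def inj_vimage_image_eq)

definition increasing_pair :: "(nat \<Rightarrow> nat) \<Rightarrow> nat \<Rightarrow> nat \<Rightarrow> nat \<Rightarrow> nat \<Rightarrow> bool" where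
  "increasing_pair w k i p j \<longleftrightarrow> i \<le> k \<and> k < j \<and> i < p \<and> p < j \<and> w p < w i \<and> w j < w p \<and>
     card (L_pos w k i) = card (R_pos w k j) \<and>
     strict_mono_on (L_pos w k i) w \<and> strict_mono_on (R_pos w k j) w"

text \<open>By the closure of \<open>B\<close> and of the chain, \<open>R_pos w k b\<close> for a
  chain member \<open>b\<close> consists of the members before it. It is thus increasing and its
  size is the rank of \<open>b\<close>, so all sizes below \<open>S\<close> occur. An early stop
  leaves an inversion inside \<open>B\<close> that ends at a chain member.\<close>

lemma R_chain:
  assumes w: "inj w" and B: "finite B" "s \<le> card B"
    and closed: "\<And>b. b \<in> B \<Longrightarrow> k < b \<and> R_pos w k b \<subseteq> B"
  shows "\<exists>S\<le>s. (\<forall>r<S. \<exists>b\<in>B. card (R_pos w k b) = r \<and> strict_mono_on (R_pos w k b) w) \<and>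
    (S = s \<or> (\<exists>b\<in>B. \<exists>p\<in>B. card (R_pos w k b) < S \<and> strict_mono_on (R_pos w k b) w \<and>
       p < b \<and> w b < w p))"
proof -
  have "inj_on int B" "inj_on (\<lambda>q. int (w q)) B"
    by (simp_all add: inj_on_def inj_eq[OF w])
  from initial_chain[OF B(1) this B(2)] obtain C where C: "C \<subseteq> B" "card C \<le> s"
    and down: "\<forall>c\<in>C. \<forall>t\<in>B. t < c \<and> w t < w c \<longrightarrow> t \<in> C"
    and mono: "\<forall>c\<in>C. \<forall>d\<in>C. c < d \<longleftrightarrow> w c < w d"
    and full: "card C = s \<or> (\<exists>c\<in>C. \<exists>t\<in>B. t < c \<and> w c < w t)"
    unfolding of_nat_less_iff by blast
  have fin: "finite C" using C(1) B(1) by (rule finite_subset)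
  have R: "R_pos w k c = {d \<in> C. d < c}" if "c \<in> C" for c
  proof
    show "R_pos w k c \<subseteq> {d \<in> C. d < c}"
      using closed[of c] C(1) down that unfolding R_pos_def by blast
    show "{d \<in> C. d < c} \<subseteq> R_pos w k c"
      using closed C(1) mono that unfolding R_pos_def by blast
  qed
  have inc: "strict_mono_on (R_pos w k c) w" if "c \<in> C" for c
    unfolding R[OF that] using mono by (auto intro!: strict_mono_onI)
  have "\<exists>b\<in>B. card (R_pos w k b) = r \<and> strict_mono_on (R_pos w k b) w" if "r < card C" for r
  proof -
    have "inj_on int C" by (simp add: inj_on_def)
    from ex_rank[OF fin this that] obtain c where c: "c \<in> C" "card {d \<in> C. int d < int c} = r"
      by blast
    then have "card (R_pos w k c) = r" unfolding R[OF c(1)] by simp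
    then show ?thesis using c(1) inc C(1) by blast
  qed
  moreover have "card (R_pos w k c) < card C" if "c \<in> C" for c
    unfolding R[OF that] using that fin by (intro psubset_card_mono) auto
  ultimately show ?thesis
    using C full inc by (intro exI[of _ "card C"] conjI) blast+
qed

text \<open>The mirror image of \<open>R_chain\<close>: negated positions and values turn later and
  larger entries into earlier and smaller ones.\<close>

lemma L_chain:
  assumes w: "inj w" and A: "finite A" "s \<le> card A"
    and closed: "\<And>a. a \<in> A \<Longrightarrow> a \<le> k \<and> L_pos w k a \<subseteq> A"
  shows "\<exists>S\<le>s. (\<forall>r<S. \<exists>a\<in>A. card (L_pos w k a) = r \<and> strict_mono_on (L_pos w k a) w) \<and>
    (S = s \<or> (\<exists>a\<in>A. \<exists>p\<in>A. card (L_pos w k a) < S \<and> strict_mono_on (L_pos w k a) w \<and>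
       a < p \<and> w p < w a))"
proof -
  have "inj_on (\<lambda>q. - int q) A" "inj_on (\<lambda>q. - int (w q)) A"
    by (simp_all add: inj_on_def inj_eq[OF w])
  from initial_chain[OF A(1) this A(2)] obtain C where C: "C \<subseteq> A" "card C \<le> s"
    and down: "\<forall>c\<in>C. \<forall>t\<in>A. c < t \<and> w c < w t \<longrightarrow> t \<in> C"
    and mono: "\<forall>c\<in>C. \<forall>d\<in>C. d < c \<longleftrightarrow> w d < w c"
    and full: "card C = s \<or> (\<exists>c\<in>C. \<exists>t\<in>A. c < t \<and> w t < w c)"
    unfolding of_nat_less_iff neg_less_iff_less by blast
  have fin: "finite C" using C(1) A(1) by (rule finite_subset)
  have L: "L_pos w k c = {d \<in> C. c < d}" if "c \<in> C" for c
  proof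
    show "L_pos w k c \<subseteq> {d \<in> C. c < d}"
      using closed[of c] C(1) down that unfolding L_pos_def by blast
    show "{d \<in> C. c < d} \<subseteq> L_pos w k c"
      using closed C(1) mono that unfolding L_pos_def by blast
  qed
  have inc: "strict_mono_on (L_pos w k c) w" if "c \<in> C" for c
    unfolding L[OF that] using mono by (auto intro!: strict_mono_onI)
  have "\<exists>a\<in>A. card (L_pos w k a) = r \<and> strict_mono_on (L_pos w k a) w" if "r < card C" for r
  proof -
    have "inj_on (\<lambda>q. - int q) C" by (simp add: inj_on_def)
    from ex_rank[OF fin this that] obtain c where c: "c \<in> C" "card {d \<in> C. - int d < - int c} = r"
      by blast
    then have "card (L_pos w k c) = r" unfolding L[OF c(1)] by simp
    then show ?thesis using c(1) inc C(1) by blast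
  qed
  moreover have "card (L_pos w k c) < card C" if "c \<in> C" for c
    unfolding L[OF that] using that fin by (intro psubset_card_mono) auto
  ultimately show ?thesis
    using C full inc by (intro exI[of _ "card C"] conjI) blast+
qed

text \<open>
  If one of the two chains stops early, the inversion that stops it is the middle of a decreasing
  triple, and the other chain supplies an end of the matching size.
\<close>

lemma ex_increasing_pair:
  assumes w: "inj w" and A: "finite A" "Suc m \<le> card A" and B: "finite B" "Suc m \<le> card B"
    and closedA: "\<And>a. a \<in> A \<Longrightarrow> a \<le> k \<and> L_pos w k a \<subseteq> A"
    and closedB: "\<And>b. b \<in> B \<Longrightarrow> k < b \<and> R_pos w k b \<subseteq> B"
    and above: "\<And>a b. a \<in> A \<Longrightarrow> b \<in> B \<Longrightarrow> w b < w a"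
    and middle: "\<And>a b. a \<in> A \<Longrightarrow> b \<in> B \<Longrightarrow> card (L_pos w k a) = m \<Longrightarrow> card (R_pos w k b) = m \<Longrightarrow>
      \<exists>p. a < p \<and> p < b \<and> w p < w a \<and> w b < w p"
  shows "\<exists>i\<in>A. \<exists>p. \<exists>j\<in>B. increasing_pair w k i p j"
proof -
  obtain S where S: "S \<le> Suc m"
    and L_all: "\<And>r. r < S \<Longrightarrow> \<exists>a\<in>A. card (L_pos w k a) = r \<and> strict_mono_on (L_pos w k a) w"
    and L_stop: "S = Suc m \<or> (\<exists>a\<in>A. \<exists>p\<in>A. card (L_pos w k a) < S \<and>
      strict_mono_on (L_pos w k a) w \<and> a < p \<and> w p < w a)"
    using L_chain[OF w A closedA] by blast
  obtain S' where S': "S' \<le> Suc m"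
    and R_all: "\<And>r. r < S' \<Longrightarrow> \<exists>b\<in>B. card (R_pos w k b) = r \<and> strict_mono_on (R_pos w k b) w"
    and R_stop: "S' = Suc m \<or> (\<exists>b\<in>B. \<exists>p\<in>B. card (R_pos w k b) < S' \<and>
      strict_mono_on (R_pos w k b) w \<and> p < b \<and> w b < w p)"
    using R_chain[OF w B closedB] by blast
  \<comment> \<open>Both \<open>a\<close> and \<open>p\<close> lie in \<open>A\<close>, so every
    \<open>b\<close> in \<open>B\<close> is to the right of \<open>p\<close> and has a smaller
    value: \<open>p\<close> is a middle entry for any \<open>b\<close>.\<close>
  have fromL: ?thesis if a: "a \<in> A" "p \<in> A" "card (L_pos w k a) < S'"
    "strict_mono_on (L_pos w k a) w" "a < p" "w p < w a" for a p
  proof -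
    obtain b where b: "b \<in> B" "card (R_pos w k b) = card (L_pos w k a)" "strict_mono_on (R_pos w k b) w"
      using R_all[OF a(3)] by blast
    have "a \<le> k" "k < b" "p < b" "w b < w p"
      using closedA[OF a(1)] closedA[OF a(2)] closedB[OF b(1)] above[OF a(2) b(1)] by auto
    then show ?thesis using a b unfolding increasing_pair_def by metis
  qed
  have fromR: ?thesis if b: "b \<in> B" "p \<in> B" "card (R_pos w k b) < S"
    "strict_mono_on (R_pos w k b) w" "p < b" "w b < w p" for b p
  proof -
    obtain a where a: "a \<in> A" "card (L_pos w k a) = card (R_pos w k b)" "strict_mono_on (L_pos w k a) w"
      using L_all[OF b(3)] by blast
    have "a \<le> k" "k < b" "a < p" "w p < w a"
      using closedA[OF a(1)] closedB[OF b(1)] closedB[OF b(2)] above[OF a(1) b(2)] by auto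
    then show ?thesis using a b unfolding increasing_pair_def by metis
  qed
  \<comment> \<open>Unless both chains reach full size, the shorter one has stopped at an inversion;
    the size at its end is below its own length and hence occurs on the other side.\<close>
  consider "S = Suc m" "S' = Suc m" | "S < Suc m" "S \<le> S'" | "S' < Suc m" "S' \<le> S"
    using S S' by linarith
  then show ?thesis
  proof cases
    case 1
    obtain a b where a: "a \<in> A" "card (L_pos w k a) = m" "strict_mono_on (L_pos w k a) w"
      and b: "b \<in> B" "card (R_pos w k b) = m" "strict_mono_on (R_pos w k b) w"
      using L_all[of m] R_all[of m] 1 by auto
    then show ?thesis
      using middle[OF a(1) b(1) a(2) b(2)] closedA[OF a(1)] closedB[OF b(1)]
      unfolding increasing_pair_def by metis
  next
    case 2
    then show ?thesis using L_stop fromL by fastforce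
  next
    case 3
    then show ?thesis using R_stop fromR by fastforce
  qed
qed

section \<open>From antichains to increasing pairs and back\<close>

lemma braid_triple_imp_increasing_pair:
  assumes w: "w permutes {1..n}" and tr: "braid_triple n w k i p j"
  shows "\<exists>i p j. i \<in> {1..n} \<and> j \<in> {1..n} \<and> increasing_pair w k i p j"
proof -
  let ?D = "strictly_below n w {i, p, j}"
  let ?U = "strictly_above n w {i, p, j}"
  have T: "i < p" "p < j" "w p < w i" "w j < w p" "i \<in> {1..n}" "p \<in> {1..n}" "j \<in> {1..n}"
    and D: "card ?D < k" and U: "card ?U + k < n"
    using tr by (auto simp: braid_triple_def)
  have wi: "inj w" using w by (rule permutes_inj)
  have finD: "finite ?D" and finU: "finite ?U"
    by (auto simp: strictly_below_def strictly_above_def)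
  show ?thesis
  proof (cases "p \<le> k")
    case True
    \<comment> \<open>The size parameter is \<open>card (L_pos w k i)\<close>, one less than the
      size of \<open>A\<close>; \<open>B\<close> collects the right ends for which \<open>p\<close>
      can be the middle.\<close>
    define A where "A = insert i (L_pos w k i)"
    define B where "B = {q \<in> {k<..n}. w q < w p}"
    have cA: "card A = Suc (card (L_pos w k i))"
      by (simp add: A_def L_pos_def[of w k i])
    \<comment> \<open>Positions after \<open>k\<close> outside \<open>B\<close> are strictly above
      \<open>p\<close>, and \<open>L_pos w k i\<close> is strictly above \<open>i\<close>. The bound
      on \<open>?U\<close> thus leaves more than \<open>card (L_pos w k i)\<close> positions in
      \<open>B\<close>.\<close>
    have split: "({k<..n} - B) \<union> L_pos w k i \<subseteq> ?U"
    proof -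
      have "w p < w q" if "q \<in> {k<..n} - B" for q
      proof -
        have "w q \<noteq> w p" using that True wi by (auto simp: inj_eq)
        then show ?thesis using that by (auto simp: B_def)
      qed
      then show ?thesis
        using True U unfolding strictly_above_def L_pos_def by fastforce
    qed
    have BnS: "B \<subseteq> {k<..n}" "finite B" by (auto simp: B_def)
    have "card (({k<..n} - B) \<union> L_pos w k i) = card ({k<..n} - B) + card (L_pos w k i)"
      by (rule card_Un_disjoint) (auto simp: L_pos_def)
    then have "n - k - card B + card (L_pos w k i) \<le> card ?U"
      using card_mono[OF finU split] card_Diff_subset[OF BnS(2,1)] by simp
    moreover have "card B \<le> n - k" using card_mono[OF _ BnS(1)] by simp
    ultimately have cB: "Suc (card (L_pos w k i)) \<le> card B" using U by linarith
    have "\<exists>i\<in>A. \<exists>p. \<exists>j\<in>B. increasing_pair w k i p j"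
    proof (rule ex_increasing_pair[OF wi _ _ BnS(2) cB])
      show "finite A" "Suc (card (L_pos w k i)) \<le> card A" using cA by (simp_all add: A_def)
      show "a \<le> k \<and> L_pos w k a \<subseteq> A" if "a \<in> A" for a
        using that T True by (auto simp: A_def L_pos_def)
      show "k < b \<and> R_pos w k b \<subseteq> B" if "b \<in> B" for b
        using that by (auto simp: B_def R_pos_def)
      show "w b < w a" if "a \<in> A" "b \<in> B" for a b
        using that T by (auto simp: A_def B_def L_pos_def)
      show "\<exists>p. a < p \<and> p < b \<and> w p < w a \<and> w b < w p"
        if ab: "a \<in> A" "b \<in> B" "card (L_pos w k a) = card (L_pos w k i)" for a b
      proof -
        \<comment> \<open>Every other member of \<open>A\<close> has a strictly smaller set, so a
          set of full size belongs to \<open>i\<close>, for which \<open>p\<close> is a middle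
          entry.\<close>
        have "a = i"
        proof (rule ccontr)
          assume "a \<noteq> i"
          then have "L_pos w k a \<subset> L_pos w k i" using ab(1) by (auto simp: A_def L_pos_def)
          then show False using psubset_card_mono[OF finite_L_pos] ab(3) by (metis less_irrefl)
        qed
        then show ?thesis using T True ab(2) by (auto simp: B_def)
      qed
    qed
    moreover have "A \<subseteq> {1..n}" using T U by (auto simp: A_def L_pos_def)
    moreover have "B \<subseteq> {1..n}" by (auto simp: B_def)
    ultimately show ?thesis by blast
  next
    case False
    \<comment> \<open>The mirror case: the bound on \<open>?D\<close> now makes the left side large
      enough.\<close>
    define A where "A = {q \<in> {1..k}. w p < w q}"
    define B where "B = insert j (R_pos w k j)"
    have cB: "card B = Suc (card (R_pos w k j))"
      by (simp add: B_def R_pos_def[of w k j])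
    have split: "({1..k} - A) \<union> R_pos w k j \<subseteq> ?D"
    proof -
      have "w q < w p" if "q \<in> {1..k} - A" for q
      proof -
        have "w q \<noteq> w p" using that False wi by (auto simp: inj_eq)
        then show ?thesis using that by (auto simp: A_def)
      qed
      then show ?thesis
        using False U T unfolding strictly_below_def R_pos_def by fastforce
    qed
    have AnS: "A \<subseteq> {1..k}" "finite A" by (auto simp: A_def)
    have "card (({1..k} - A) \<union> R_pos w k j) = card ({1..k} - A) + card (R_pos w k j)"
      by (rule card_Un_disjoint) (auto simp: R_pos_def)
    then have "k - card A + card (R_pos w k j) \<le> card ?D"
      using card_mono[OF finD split] card_Diff_subset[OF AnS(2,1)] by simp
    moreover have "card A \<le> k" using card_mono[OF _ AnS(1)] by simp
    ultimately have cA: "Suc (card (R_pos w k j)) \<le> card A" using D by linarith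
    have "\<exists>i\<in>A. \<exists>p. \<exists>j\<in>B. increasing_pair w k i p j"
    proof (rule ex_increasing_pair[OF wi AnS(2) cA])
      show "finite B" "Suc (card (R_pos w k j)) \<le> card B" using cB by (simp_all add: B_def)
      show "a \<le> k \<and> L_pos w k a \<subseteq> A" if "a \<in> A" for a
        using that by (auto simp: A_def L_pos_def)
      show "k < b \<and> R_pos w k b \<subseteq> B" if "b \<in> B" for b
        using that T False by (auto simp: B_def R_pos_def)
      show "w b < w a" if "a \<in> A" "b \<in> B" for a b
        using that T by (auto simp: A_def B_def R_pos_def)
      show "\<exists>p. a < p \<and> p < b \<and> w p < w a \<and> w b < w p"
        if ab: "a \<in> A" "b \<in> B" "card (R_pos w k b) = card (R_pos w k j)" for a b
      proof -
        have "b = j"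
        proof (rule ccontr)
          assume "b \<noteq> j"
          then have "R_pos w k b \<subset> R_pos w k j" using ab(2) by (auto simp: B_def R_pos_def)
          then show False using psubset_card_mono[OF finite_R_pos] ab(3) by (metis less_irrefl)
        qed
        then show ?thesis using T False ab(1) by (intro exI[of _ p]) (auto simp: A_def)
      qed
    qed
    moreover have "A \<subseteq> {1..n}" using U by (auto simp: A_def)
    moreover have "B \<subseteq> {1..n}" using T by (auto simp: B_def R_pos_def)
    ultimately show ?thesis by blast
  qed
qed

text \<open>A middle position nearest to the cut after \<open>k\<close> has no other candidate between itself and the cut.\<close>

lemma balanced_pair_imp_braid_triple:
  assumes w: "w permutes {1..n}" and ij: "i \<in> {1..n}" "j \<in> {1..n}" "i \<le> k" "k < j"
    and p0: "i < p\<^sub>0" "p\<^sub>0 < j" "w p\<^sub>0 < w i" "w j < w p\<^sub>0"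
    and card: "card (L_pos w k i) = card (R_pos w k j)"
  shows "\<exists>p. braid_triple n w k i p j"
proof -
  have wi: "inj w" using w by (rule permutes_inj)
  let ?P = "\<lambda>p. i < p \<and> p < j \<and> w p < w i \<and> w j < w p"
  obtain p where p: "?P p" and nearest: "\<And>q. ?P q \<Longrightarrow> nat \<bar>int p - int k\<bar> \<le> nat \<bar>int q - int k\<bar>"
    using ex_has_least_nat[of ?P p\<^sub>0 "\<lambda>p. nat \<bar>int p - int k\<bar>"] p0 by blast
  have gap: "\<not> ?P q" if "p < q \<and> q \<le> k \<or> k < q \<and> q < p" for q
    using nearest[of q] that by linarith
  let ?D = "strictly_below n w {i, p, j}"
  let ?U = "strictly_above n w {i, p, j}"
  let ?L = "L_pos w k i"
  let ?R = "R_pos w k j"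
  have ne: "w q \<noteq> w r" if "q \<noteq> r" for q r using that wi by (simp add: inj_eq)
  \<comment> \<open>Up to \<open>k\<close>, neither \<open>i\<close> nor a position in
    \<open>?L\<close> is below the triple. After \<open>k\<close>, the choice of \<open>p\<close>
    leaves only positions below \<open>j\<close>.\<close>
  have D: "?D \<subseteq> ({1..k} - insert i ?L) \<union> ?R"
  proof
    fix q assume "q \<in> ?D"
    then have q: "q \<in> {1..n}" "q < i \<and> w q < w i \<or> q < p \<and> w q < w p \<or> q < j \<and> w q < w j"
      by (auto simp: strictly_below_def)
    show "q \<in> ({1..k} - insert i ?L) \<union> ?R"
    proof (cases "q \<le> k")
      case True
      then show ?thesis using q p by (auto simp: L_pos_def)
    next
      case False
      then have "q < j" "w q < w j" using q(2) p gap[of q] ij ne[of q j] by (auto simp: not_less order_le_less)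
      then show ?thesis using False by (auto simp: R_pos_def)
    qed
  qed
  have U: "?U \<subseteq> ({k<..n} - insert j ?R) \<union> ?L"
  proof
    fix q assume "q \<in> ?U"
    then have q: "q \<in> {1..n}" "i < q \<and> w i < w q \<or> p < q \<and> w p < w q \<or> j < q \<and> w j < w q"
      by (auto simp: strictly_above_def)
    show "q \<in> ({k<..n} - insert j ?R) \<union> ?L"
    proof (cases "k < q")
      case True
      then show ?thesis using q p by (auto simp: R_pos_def)
    next
      case False
      then have "i < q" "w i < w q" using q(2) p gap[of q] ij ne[of q i] by (auto simp: not_less order_le_less)
      then show ?thesis using False by (auto simp: L_pos_def)
    qed
  qed
  have iL: "insert i ?L \<subseteq> {1..k}" "i \<notin> ?L" and jR: "insert j ?R \<subseteq> {k<..n}" "j \<notin> ?R"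
    using ij by (auto simp: L_pos_def R_pos_def)
  have "card ?D \<le> card ({1..k} - insert i ?L) + card ?R"
    using card_mono[OF _ D] card_Un_le[of "{1..k} - insert i ?L" ?R] by simp
  also have "card ({1..k} - insert i ?L) = k - Suc (card ?L)"
    using card_Diff_subset[OF _ iL(1)] iL(2) by simp
  moreover have "Suc (card ?L) \<le> k" using card_mono[OF _ iL(1)] iL(2) by simp
  \<comment> \<open>With equal sizes the contributions of \<open>?L\<close> and \<open>?R\<close>
    cancel, and the removal of \<open>i\<close> leaves at most \<open>k - 1\<close>; the removal of
    \<open>j\<close> likewise leaves at most \<open>n - k - 1\<close> above.\<close>
  ultimately have cD: "card ?D < k" using card by simp
  have "card ?U \<le> card ({k<..n} - insert j ?R) + card ?L"
    using card_mono[OF _ U] card_Un_le[of "{k<..n} - insert j ?R" ?L] by simp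
  also have "card ({k<..n} - insert j ?R) = n - k - Suc (card ?R)"
    using card_Diff_subset[OF _ jR(1)] jR(2) by simp
  moreover have "Suc (card ?R) \<le> n - k" using card_mono[OF _ jR(1)] jR(2) by simp
  ultimately have "card ?U + k < n" using card by simp
  then have "braid_triple n w k i p j"
    using cD p ij by (auto simp: braid_triple_def)
  then show ?thesis by blast
qed

theorem theorem5p1:
  fixes n k :: nat and w :: "nat \<Rightarrow> nat"
  assumes "w permutes {1..n}" and "k \<in> {1..n-1}"
  shows "max_occ n k w > min_occ n k w \<longleftrightarrow>
    (\<exists>i p j. i \<in> {1..n} \<and> p \<in> {1..n} \<and> j \<in> {1..n} \<and>
       i < p \<and> p < j \<and> w i > w p \<and> w p > w j \<and> i \<le> k \<and> k < j \<and>
       card (L_set w k i) = card (R_set w k j) \<and>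
       appear_increasing w (L_set w k i) \<and> appear_increasing w (R_set w k j))"
    (is "?lhs \<longleftrightarrow> ?rhs")
proof -
  have wi: "inj w" using assms(1) by (rule permutes_inj)
  have card: "card (w ` S) = card S" for S
    using wi by (simp add: card_image inj_on_subset)
  have rhs: "?rhs \<longleftrightarrow> (\<exists>i p j. i \<in> {1..n} \<and> p \<in> {1..n} \<and> j \<in> {1..n} \<and> increasing_pair w k i p j)"
    unfolding L_set_eq R_set_eq appear_increasing_image[OF wi] card increasing_pair_def by blast
  show ?thesis
  proof
    assume ?lhs
    then obtain xs ys where xs: "reduced_word n xs" "apply_adj_transps xs = w"
      and ys: "reduced_word n ys" "apply_adj_transps ys = w" and ne: "count_list xs k \<noteq> count_list ys k"
      using min_occ_less_max_occ_iff[OF assms(1)] reduced_decompositions_eq[OF assms(1)] by auto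
    have "apply_adj_transps xs = apply_adj_transps ys" using xs ys by simp
    from count_differs_imp_braid[OF xs(1) ys(1) this ne] obtain i p j where "braid_triple n w k i p j"
      using reduced_braid_imp_braid_triple xs(2) by metis
    from braid_triple_imp_increasing_pair[OF assms(1) this] obtain i p j where
      *: "i \<in> {1..n}" "j \<in> {1..n}" "increasing_pair w k i p j" by blast
    then have "p \<in> {1..n}" by (auto simp: increasing_pair_def)
    then show ?rhs unfolding rhs using * by blast
  next
    assume ?rhs
    then obtain i p j where "braid_triple n w k i p j"
      unfolding rhs increasing_pair_def using balanced_pair_imp_braid_triple[OF assms(1)] by metis
    from braid_triple_imp_count_differs[OF assms(1) this] show ?lhs
      using min_occ_less_max_occ_iff[OF assms(1)] reduced_decompositions_eq[OF assms(1)] by blast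
  qed
qed

end
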